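(* Any complete bipartite graph $K_{r,t}$ with $r\ge t\ge 1$ is $r$-metric antidimensional.
   Context: Graphs are finite and simple; $K_{r,t}$ is the complete bipartite graph with parts of sizes $r$ and $t$; $d_G(u,v)$ is the length of a shortest path between $u$ and $v$. For an ordered set $S=\{u_1,\dots,u_m\}\subseteq V(G)$ ($m\ge1$) and $v\in V(G)$, let $r(v|S)=(d_G(v,u_1),\dots,d_G(v,u_m))$. A nonempty proper subset $S\subset V(G)$ is a $k$-antiresolving set if $k$ is the greatest positive integer such that for every $v\in V(G)-S$ there exist at least $k-1$ different vertices $v_1,\dots,v_{k-1}\in V(G)-S$, all different from $v$, with $r(v|S)=r(v_1|S)=\cdots=r(v_{k-1}|S)$. A connected graph $G$ is $k$-metric antidimensional if $k$ is the largest integer such that $G$ contains a $k$-antiresolving set. *)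

theory Defs
  imports "Graph_Theory.Graph_Theory"
begin

text \<open>
  A finite simple graph is a symmetric digraph in the sense of the locale \<^locale>\<open>graph\<close>: finitely
  many vertices, no loops, no parallel arcs.  With unit arc weights, the library's shortest-path
  function is the usual distance; see \<open>graph_dist_shortest_path\<close> below.
\<close>

definition graph_dist :: "('a, 'b) pre_digraph \<Rightarrow> 'a \<Rightarrow> 'a \<Rightarrow> ereal" where
  "graph_dist G u v = wf_digraph.\<mu> G (\<lambda>_. 1) u v"

lemma (in fin_digraph) graph_dist_shortest_path:
  assumes "u \<rightarrow>\<^sup>* v"
  shows "\<exists>p. apath u p v \<and> graph_dist G u v = ereal (real (length p))
    \<and> (\<forall>q. apath u q v \<longrightarrow> length p \<le> length q)"
proof -
  have cost: "awalk_cost (\<lambda>_. 1) p = real (length p)" for p :: "'b list"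
    by (induct p) auto
  obtain p where p: "apath u p v" "graph_dist G u v = ereal (real (length p))"
    using min_cost_awalk[OF assms, of "\<lambda>_. 1"] by (auto simp: graph_dist_def cost)
  have "length p \<le> length q" if "apath u q v" for q
    using min_cost_le_walk_cost[of u q v "\<lambda>_. 1"] that p(2)
    by (simp add: apath_def graph_dist_def cost)
  with p show ?thesis by blast
qed

text \<open>An ordered set of vertices is a list without repetitions.\<close>

definition metric_rep :: "('a, 'b) pre_digraph \<Rightarrow> 'a list \<Rightarrow> 'a \<Rightarrow> ereal list" where
  "metric_rep G S v = map (\<lambda>u. graph_dist G v u) S"

definition antiresolves :: "('a, 'b) pre_digraph \<Rightarrow> nat \<Rightarrow> 'a list \<Rightarrow> bool" where
  "antiresolves G k S \<longleftrightarrow> k \<ge> 1 \<and>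
    (\<forall>v \<in> verts G - set S. \<exists>W \<subseteq> verts G - set S. v \<notin> W \<and> card W = k - 1 \<and>
      (\<forall>w \<in> W. metric_rep G S v = metric_rep G S w))"

definition antiresolving_set :: "('a, 'b) pre_digraph \<Rightarrow> nat \<Rightarrow> 'a list \<Rightarrow> bool" where
  "antiresolving_set G k S \<longleftrightarrow> distinct S \<and> S \<noteq> [] \<and> set S \<subset> verts G \<and>
    antiresolves G k S \<and> (\<forall>j. antiresolves G j S \<longrightarrow> j \<le> k)"

definition metric_antidimensional :: "('a, 'b) pre_digraph \<Rightarrow> nat \<Rightarrow> bool" where
  "metric_antidimensional G k \<longleftrightarrow> graph G \<and> Digraph_Component.connected G \<and>
    (\<exists>S. antiresolving_set G k S) \<and> (\<forall>j S. antiresolving_set G j S \<longrightarrow> j \<le> k)"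

end

theory Submission
  imports Defs
begin

text \<open>
  A vertex outside \<open>S\<close> determines its part through its set of neighbours in the nonempty set \<open>S\<close>, so
  each class of vertices with equal representation lies in one part and has at most \<open>r\<close> elements.
  Taking the part of size \<open>t\<close> as \<open>S\<close> turns the other part into a single class.
\<close>

text \<open>Adjacency is the only distance information the proof needs. The endpoints are kept
  distinct because \<open>fin_digraph\<close> allows loops, and a vertex with a loop still has
  distance 0 to itself.\<close>

lemma (in fin_digraph) graph_dist_eq_1_iff:
  assumes "u \<noteq> v"
  shows "graph_dist G u v = 1 \<longleftrightarrow> u \<rightarrow>\<^bsub>G\<^esub> v"
proof
  assume *: "graph_dist G u v = 1"
  \<comment> \<open>An unreachable vertex would be at infinite distance.\<close>
  then have "u \<rightarrow>\<^sup>* v"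
    using shortest_path_inf[of u v "\<lambda>_. 1"] by (force simp: graph_dist_def)
  then obtain p where p: "apath u p v" "graph_dist G u v = ereal (real (length p))"
    using graph_dist_shortest_path by blast
  with * have "length p = Suc 0" by (simp add: one_ereal_def)
  then obtain e where "p = [e]" by (cases p) auto
  with p(1) show "u \<rightarrow>\<^bsub>G\<^esub> v" by (auto simp: apath_simps intro: in_arcs_imp_in_arcs_ends)
next
  assume adj: "u \<rightarrow>\<^bsub>G\<^esub> v"
  then obtain p where p: "apath u p v" "graph_dist G u v = ereal (real (length p))"
      and min: "\<And>q. apath u q v \<Longrightarrow> length p \<le> length q"
    using graph_dist_shortest_path[of u v] by blast
  from adj obtain e where "e \<in> arcs G" "tail G e = u" "head G e = v"
    by (auto simp: arcs_ends_conv)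
  with assms have "apath u [e] v" by (auto simp: apath_simps)
  from min[OF this] have "length p \<le> 1" by simp
  moreover have "p \<noteq> []" using p(1) assms by (auto simp: apath_Nil_iff)
  ultimately have "length p = 1" by (cases p) auto
  with p(2) show "graph_dist G u v = 1" by (simp add: one_ereal_def)
qed

text \<open>Vertices in different parts are adjacent; two in the same part are joined through any
  vertex of the other part.\<close>

lemma (in wf_digraph) bipartite_connected:
  assumes "verts G = U \<union> V" "U \<noteq> {}" "V \<noteq> {}" "arcs_ends G = U \<times> V \<union> V \<times> U"
  shows "connected G"
proof -
  have across: "x \<rightarrow>\<^sup>* y" if "x \<in> U \<and> y \<in> V \<or> x \<in> V \<and> y \<in> U" for x y
    using that assms(4) by (intro reachable_adjI) auto
  have "x \<rightarrow>\<^sup>* y" if "x \<in> verts G" "y \<in> verts G" for x y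
  proof -
    from assms(2,3) obtain a b where "a \<in> U" "b \<in> V" by blast
    with that assms(1) show ?thesis
      using across reachable_trans[of x a y] reachable_trans[of x b y] by blast
  qed
  with assms(1,2) show ?thesis
    by (auto simp: connected_def intro!: strongly_connectedI reachable_mk_symmetricI)
qed

text \<open>This one bound serves both maximality conditions: over \<open>j\<close> for a fixed set,
  and over all antiresolving sets.\<close>

lemma (in fin_digraph) bipartite_antiresolves_le:
  assumes verts: "verts G = U \<union> V" and disj: "U \<inter> V = {}"
    and ends: "arcs_ends G = U \<times> V \<union> V \<times> U"
    and card: "card U \<le> r" "card V \<le> r"
    and S: "S \<noteq> []" "set S \<subset> verts G" and anti: "antiresolves G k S"
  shows "k \<le> r"
proof -
  have fin: "finite U" "finite V" using finite_verts verts by auto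
  obtain v where v: "v \<in> verts G - set S" using S(2) by blast
  with anti obtain W where W: "W \<subseteq> verts G - set S" "v \<notin> W" "card W = k - 1"
      and rep: "\<And>w. w \<in> W \<Longrightarrow> metric_rep G S v = metric_rep G S w"
    unfolding antiresolves_def by blast
  obtain s where s: "s \<in> set S" using S(1) by (cases S) auto
  \<comment> \<open>One coordinate is enough. As \<open>v\<close> and \<open>w\<close> lie outside
    \<open>S\<close>, they differ from \<open>s\<close>, so equal distances to \<open>s\<close> give
    equal adjacency.\<close>
  have same: "(v \<rightarrow>\<^bsub>G\<^esub> s) = (w \<rightarrow>\<^bsub>G\<^esub> s)" if "w \<in> W" for w
  proof -
    have "graph_dist G v s = graph_dist G w s"
      using rep[OF that] s by (auto simp: metric_rep_def)
    moreover have "v \<noteq> s" "w \<noteq> s" using v that W(1) s by auto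
    ultimately show ?thesis using graph_dist_eq_1_iff by metis
  qed
  have "s \<in> U \<union> V" "v \<in> U \<union> V" "W \<subseteq> U \<union> V" using s S(2) v W(1) verts by auto
  \<comment> \<open>The neighbours of \<open>s\<close> are exactly the part opposite to
    \<open>s\<close>, so adjacency to \<open>s\<close> tells the parts apart.\<close>
  with same disj have "insert v W \<subseteq> U \<or> insert v W \<subseteq> V"
    unfolding ends by blast
  then have "card (insert v W) \<le> r"
    using card card_mono[OF fin(1)] card_mono[OF fin(2)] by (meson order_trans)
  moreover have "finite W" using W(1) finite_verts by (auto intro: finite_subset)
  \<comment> \<open>\<open>insert v W\<close> has \<open>Suc (k - 1)\<close> elements, which is at
    least \<open>k\<close> even under truncated subtraction.\<close>
  ultimately show ?thesis using W(2,3) by simp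
qed

theorem mainTheorem10:
  fixes G :: "('a, 'b) pre_digraph" and r t :: nat
  assumes "t \<ge> 1" and "r \<ge> t"
    and "complete_bipartite_digraph r t G"
  shows "metric_antidimensional G r"
proof -
  from assms(3) have "graph G" by (simp add: complete_bipartite_digraph_def)
  then interpret graph G .
  from assms(3) obtain U V where UV: "verts G = U \<union> V" "U \<inter> V = {}" "card U = r" "card V = t"
      and ends: "arcs_ends G = U \<times> V \<union> V \<times> U"
    unfolding complete_bipartite_digraph_def by blast
  have fin: "finite U" "finite V" using finite_verts UV(1) by auto
  have ne: "U \<noteq> {}" "V \<noteq> {}" using UV assms(1,2) by auto
  \<comment> \<open>Here \<open>r \<ge> t\<close> makes \<open>r\<close> a bound for both
    parts.\<close>
  have le: "k \<le> r" if "S \<noteq> []" "set S \<subset> verts G" "antiresolves G k S" for k S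
    using bipartite_antiresolves_le[OF UV(1,2) ends _ _ that] UV(3,4) assms(2) by simp
  obtain S where S: "set S = V" "distinct S" using finite_distinct_list[OF fin(2)] by blast
  have S': "S \<noteq> []" "set S \<subset> verts G" using S(1) ne UV(1,2) by auto
  have outside: "verts G - set S = U" using S(1) UV(1,2) by auto
  \<comment> \<open>Every vertex of \<open>U\<close> is adjacent to all of \<open>V\<close>, so all
    coordinates are 1 and \<open>U - {v}\<close> can serve as the witness for
    \<open>v\<close>.\<close>
  have rep: "metric_rep G S u = map (\<lambda>_. 1) S" if "u \<in> U" for u
    unfolding metric_rep_def
  proof (rule map_cong[OF refl])
    fix x assume "x \<in> set S"
    with that S(1) UV(2) have "u \<noteq> x" "u \<rightarrow>\<^bsub>G\<^esub> x" unfolding ends by auto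
    then show "graph_dist G u x = 1" by (simp add: graph_dist_eq_1_iff)
  qed
  have "antiresolves G r S"
    unfolding antiresolves_def outside
  proof (intro conjI ballI)
    show "r \<ge> 1" using assms(1,2) by simp
    fix v assume "v \<in> U"
    then show "\<exists>W\<subseteq>U. v \<notin> W \<and> card W = r - 1 \<and> (\<forall>w\<in>W. metric_rep G S v = metric_rep G S w)"
      using UV(3) fin(1) rep by (intro exI[of _ "U - {v}"]) auto
  qed
  then have "antiresolving_set G r S"
    unfolding antiresolving_set_def using S(2) S' le by blast
  moreover have "j \<le> r" if "antiresolving_set G j S" for j S
    using that le unfolding antiresolving_set_def by blast
  ultimately show ?thesis
    unfolding metric_antidimensional_def
    using \<open>graph G\<close> bipartite_connected[OF UV(1) ne ends] by blast
qed

end
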